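(* Let $X$ be a real-valued random variable (dimension $m=1$) with distribution $F$. Then $\sigma_H(F)<\infty$ if and only if $\mathbb{E}|X|<\infty$. Additionally, if $\mathbb{E}|X|<\infty$, then $\sigma_\Delta(F)<\infty$.
   Context: For a distribution $F$ on $\mathbb{R}$ and $X\sim F$, the halfspace depth is $d_H(x,F)=\min\{\mathbb{P}(X\le x),\mathbb{P}(X\ge x)\}$ and the simplicial depth is $d_\Delta(x,F)=\mathbb{P}(x\in\Delta[X_1,X_2])$, where $X_1,X_2$ are i.i.d. with distribution $F$ and $\Delta[x_1,x_2]$ is the closed interval with endpoints $x_1,x_2$. The dispersion measures are $\sigma_H(F)=\int_{\mathbb{R}}d_H(x,F)\,dx$ and $\sigma_\Delta(F)=\int_{\mathbb{R}}d_\Delta(x,F)\,dx$. *)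

theory Defs
  imports "HOL-Probability.Probability"
begin

definition halfspace_depth :: "real \<Rightarrow> real measure \<Rightarrow> real" where
  "halfspace_depth x F = min (measure F {..x}) (measure F {x..})"

(* The product measure F \<Otimes>\<^sub>M F is the joint law of two independent variables with law F;
   closed_segment also covers the case where the first endpoint is the larger one. *)
definition simplicial_depth :: "real \<Rightarrow> real measure \<Rightarrow> real" where
  "simplicial_depth x F =
     measure (F \<Otimes>\<^sub>M F) {p \<in> space (F \<Otimes>\<^sub>M F). x \<in> closed_segment (fst p) (snd p)}"

(* The dispersions take values in ennreal: the integrals of the nonnegative depths may diverge. *)
definition halfspace_dispersion :: "real measure \<Rightarrow> ennreal" where
  "halfspace_dispersion F = (\<integral>\<^sup>+ x. ennreal (halfspace_depth x F) \<partial>lborel)"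

definition simplicial_dispersion :: "real measure \<Rightarrow> ennreal" where
  "simplicial_dispersion F = (\<integral>\<^sup>+ x. ennreal (simplicial_depth x F) \<partial>lborel)"

end

theory Submission
  imports Defs
begin

text \<open>
  Put \<open>T x = F {y. x \<in> closed_segment 0 y}\<close>, the tail of \<open>F\<close> beyond \<open>x\<close> on the far side of the
  origin. By Tonelli, \<open>\<integral> T = E |X|\<close>. The halfspace depth is at most \<open>T\<close>, and the simplicial depth
  at most \<open>2 T\<close>, because a point between \<open>y1\<close> and \<open>y2\<close> lies between the origin and one of them.
  Conversely, outside a compact interval \<open>[-R, R]\<close> the half-line pointing to the origin has
  probability at least \<open>1/2\<close>, so that \<open>T\<close> is there at most twice the halfspace depth.
\<close>

lemma mem_closed_segment_0_real_iff:
  "x \<in> closed_segment 0 y \<longleftrightarrow> 0 \<le> x \<and> x \<le> y \<or> y \<le> x \<and> x \<le> 0" for x y :: real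
  by (auto simp: closed_segment_eq_real_ivl)

text \<open>Joint measurability in \<open>x\<close> and \<open>y\<close> is what Tonelli requires;
  as a combination of inequalities between coordinates, membership is a Borel condition.\<close>

lemma sets_closed_segment_0 [measurable]:
  "{p. fst p \<in> closed_segment 0 (snd p :: real)} \<in> sets (borel \<Otimes>\<^sub>M borel)"
proof -
  have "Measurable.pred (borel \<Otimes>\<^sub>M borel) (\<lambda>p :: real \<times> real. fst p \<in> closed_segment 0 (snd p))"
    unfolding mem_closed_segment_0_real_iff by measurable
  then show ?thesis
    by (simp add: pred_def space_pair_measure)
qed

lemma sets_closed_segment_0_section [measurable]:
  "{y :: real. x \<in> closed_segment 0 y} \<in> sets borel"
  unfolding mem_closed_segment_0_real_iff by measurable

context real_distribution
begin

text \<open>A two-sided layer-cake formula: \<bar>y\<bar> is the Lebesgue length of the segment from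
  the origin to \<open>y\<close>, and Tonelli exchanges this length integral with the integral over
  \<open>M\<close>.\<close>

lemma nn_integral_abs_eq_tail:
  "(\<integral>\<^sup>+ y. ennreal \<bar>y\<bar> \<partial>M) = (\<integral>\<^sup>+ x. ennreal (prob {y. x \<in> closed_segment 0 y}) \<partial>lborel)"
proof -
  interpret pair_sigma_finite lborel M
    by (intro pair_sigma_finite.intro lborel.sigma_finite_measure_axioms
        sigma_finite_measure_axioms)
  have sets: "sets (lborel \<Otimes>\<^sub>M M) = sets (borel \<Otimes>\<^sub>M borel)"
    by (intro sets_pair_measure_cong) auto
  have "case_prod (\<lambda>x y :: real. indicator (closed_segment 0 y) x :: ennreal)
      = (\<lambda>p. indicator {p. fst p \<in> closed_segment 0 (snd p)} p)"
    by (auto simp: indicator_def)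
  also have "\<dots> \<in> borel_measurable (borel \<Otimes>\<^sub>M borel)"
    by (intro borel_measurable_indicator sets_closed_segment_0)
  finally have meas: "case_prod (\<lambda>x y. indicator (closed_segment 0 y) x :: ennreal)
      \<in> borel_measurable (lborel \<Otimes>\<^sub>M M)"
    by (simp add: measurable_cong_sets[OF sets refl])
  have abs: "ennreal \<bar>y\<bar> = (\<integral>\<^sup>+ x. indicator (closed_segment 0 y) x \<partial>lborel)" for y :: real
    by (simp add: closed_segment_eq_real_ivl)
  have tail: "(\<integral>\<^sup>+ y. indicator (closed_segment 0 y) x \<partial>M)
      = ennreal (prob {y. x \<in> closed_segment 0 y})" for x
  proof -
    have "(\<integral>\<^sup>+ y. indicator (closed_segment 0 y) x \<partial>M)
        = (\<integral>\<^sup>+ y. indicator {y. x \<in> closed_segment 0 y} y \<partial>M)"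
      by (intro nn_integral_cong) (simp add: indicator_def)
    then show ?thesis
      by (simp add: emeasure_eq_measure sets_closed_segment_0_section)
  qed
  show ?thesis
    unfolding abs using Fubini'[OF meas] tail by simp
qed

lemma tail_pos: "x > 0 \<Longrightarrow> {y. x \<in> closed_segment 0 y} = {x..}"
  and tail_neg: "x < 0 \<Longrightarrow> {y. x \<in> closed_segment 0 y} = {..x}" for x :: real
  by (auto simp: closed_segment_eq_real_ivl)

lemma halfspace_depth_le_tail: "halfspace_depth x M \<le> prob {y. x \<in> closed_segment 0 y}"
proof (cases x "0 :: real" rule: linorder_cases)
  \<comment> \<open>Every segment issuing from the origin contains the origin, so the tail there is
    all of the space; elsewhere it is one of the two half-lines in the minimum.\<close>
  case equal
  then have "prob {y. x \<in> closed_segment 0 y} = 1"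
    using prob_space by simp
  then show ?thesis
    by (simp add: halfspace_depth_def min_le_iff_disj)
qed (simp_all add: halfspace_depth_def tail_pos tail_neg)

lemma simplicial_depth_le_tail:
  "simplicial_depth x M \<le> 2 * prob {y. x \<in> closed_segment 0 y}"
proof -
  interpret P: pair_prob_space M M ..
  let ?A = "{y. x \<in> closed_segment 0 y}"
  have A: "?A \<in> sets M"
    by (simp add: sets_closed_segment_0_section)
  \<comment> \<open>The segments from the origin to the two endpoints together cover the segment
    between them. Each of the two rectangles has the product measure of \<open>?A\<close>, hence the
    factor 2.\<close>
  have "simplicial_depth x M \<le> measure (M \<Otimes>\<^sub>M M) (?A \<times> space M \<union> space M \<times> ?A)"
    unfolding simplicial_depth_def
    by (rule P.finite_measure_mono)
      (use A in \<open>auto simp: closed_segment_eq_real_ivl space_pair_measure split: if_splits\<close>)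
  also have "\<dots> \<le> measure (M \<Otimes>\<^sub>M M) (?A \<times> space M) + measure (M \<Otimes>\<^sub>M M) (space M \<times> ?A)"
    using A by (intro measure_Un_le) auto
  also have "\<dots> = 2 * prob ?A"
    using A emeasure_space_1 by (simp add: measure_def emeasure_pair_measure_Times)
  finally show ?thesis .
qed

text \<open>Both half-line probabilities are monotone in \<open>x\<close>, one increasing and one
  decreasing, and monotone functions are Borel.\<close>

lemma borel_measurable_halfspace_depth: "(\<lambda>x. halfspace_depth x M) \<in> borel_measurable borel"
proof -
  have "(\<lambda>x. prob {..x}) \<in> borel_measurable borel"
    by (intro borel_measurable_mono monoI finite_measure_mono) auto
  moreover have "(\<lambda>x. - prob {x..}) \<in> borel_measurable borel"
    by (intro borel_measurable_mono monoI le_imp_neg_le finite_measure_mono) auto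
  then have "(\<lambda>x. prob {x..}) \<in> borel_measurable borel"
    by simp
  ultimately show ?thesis
    unfolding halfspace_depth_def by simp
qed

text \<open>The indicator absorbs a compact interval, where the tail is only bounded by 1. Outside
  it, either the minimum in the depth is the tail itself, or it exceeds 1/2 and twice it exceeds
  1.\<close>

lemma ex_tail_le_halfspace_depth:
  obtains R where
    "\<And>x. prob {y. x \<in> closed_segment 0 y} \<le> 2 * halfspace_depth x M + indicator {-R..R} x"
proof -
  have "eventually (\<lambda>x. cdf M x > 1/2) at_top"
    by (rule order_tendstoD[OF cdf_lim_at_top_prob]) simp
  then obtain a where a: "\<And>x. x \<ge> a \<Longrightarrow> prob {..x} > 1/2"
    by (auto simp: eventually_at_top_linorder cdf_def)
  have "eventually (\<lambda>x. cdf M x < 1/2) at_bot"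
    by (rule order_tendstoD[OF cdf_lim_at_bot]) simp
  then obtain b where b: "\<And>x. x \<le> b \<Longrightarrow> prob {..x} < 1/2"
    by (auto simp: eventually_at_bot_linorder cdf_def)
  \<comment> \<open>The limit of the cdf controls \<open>{..x}\<close>, whose complement is the open
    half-line; adding the point \<open>x\<close> can only increase its probability.\<close>
  have b': "prob {x..} > 1/2" if "x \<le> b" for x
  proof -
    have "prob {x<..} = 1 - prob {..x}"
      using prob_compl[of "{..x}"] by (simp add: Compl_eq_Diff_UNIV[symmetric])
    moreover have "prob {x<..} \<le> prob {x..}"
      by (intro finite_measure_mono) auto
    ultimately show ?thesis
      using b[OF that] by simp
  qed
  have le1: "prob A \<le> 1" for A
    by simp
  \<comment> \<open>The absolute values make \<open>R\<close> nonnegative, so that beyond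
    \<open>R\<close> or below \<open>-R\<close> both the sign of \<open>x\<close> and its comparison
    with \<open>a\<close> or \<open>b\<close> are settled.\<close>
  define R where "R = max \<bar>a\<bar> \<bar>b\<bar>"
  show thesis
  proof (rule that[of R])
    fix x
    consider "x \<in> {-R..R}" | "x > R" | "x < -R"
      by fastforce
    then show "prob {y. x \<in> closed_segment 0 y} \<le> 2 * halfspace_depth x M + indicator {-R..R} x"
    proof cases
      case 1
      then show ?thesis
        using le1[of "{y. x \<in> closed_segment 0 y}"]
        by (simp add: halfspace_depth_def add_increasing)
    next
      case 2
      then have "x > 0" "x \<ge> a"
        by (auto simp: R_def)
      then show ?thesis
        using a[of x] le1[of "{x..}"] measure_nonneg[of M "{x..}"] 2
        unfolding tail_pos[OF \<open>x > 0\<close>] halfspace_depth_def by (simp add: min_def; linarith)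
    next
      case 3
      then have "x < 0" "x \<le> b"
        by (auto simp: R_def)
      then show ?thesis
        using b'[of x] le1[of "{..x}"] measure_nonneg[of M "{..x}"] 3
        unfolding tail_neg[OF \<open>x < 0\<close>] halfspace_depth_def by (simp add: min_def; linarith)
    qed
  qed
qed

lemma halfspace_dispersion_finite_iff:
  "halfspace_dispersion M < \<infinity> \<longleftrightarrow> (\<integral>\<^sup>+ y. ennreal \<bar>y\<bar> \<partial>M) < \<infinity>"
proof
  assume "(\<integral>\<^sup>+ y. ennreal \<bar>y\<bar> \<partial>M) < \<infinity>"
  moreover have "halfspace_dispersion M \<le> (\<integral>\<^sup>+ y. ennreal \<bar>y\<bar> \<partial>M)"
    unfolding halfspace_dispersion_def nn_integral_abs_eq_tail
    by (intro nn_integral_mono ennreal_leI halfspace_depth_le_tail)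
  ultimately show "halfspace_dispersion M < \<infinity>"
    by (rule le_less_trans[rotated])
next
  assume fin: "halfspace_dispersion M < \<infinity>"
  note [measurable] = borel_measurable_halfspace_depth
  obtain R where R:
    "\<And>x. prob {y. x \<in> closed_segment 0 y} \<le> 2 * halfspace_depth x M + indicator {-R..R} x"
    using ex_tail_le_halfspace_depth by blast
  have "(\<integral>\<^sup>+ y. ennreal \<bar>y\<bar> \<partial>M)
      \<le> (\<integral>\<^sup>+ x. 2 * ennreal (halfspace_depth x M) + indicator {-R..R} x \<partial>lborel)"
    unfolding nn_integral_abs_eq_tail
  proof (rule nn_integral_mono)
    fix x
    have "halfspace_depth x M \<ge> 0"
      by (simp add: halfspace_depth_def)
    then have "ennreal (2 * halfspace_depth x M + indicator {-R..R} x)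
        = 2 * ennreal (halfspace_depth x M) + indicator {-R..R} x"
      by (simp add: ennreal_plus ennreal_mult ennreal_indicator)
    then show "ennreal (prob {y. x \<in> closed_segment 0 y})
        \<le> 2 * ennreal (halfspace_depth x M) + indicator {-R..R} x"
      using ennreal_leI[OF R[of x]] by simp
  qed
  also have "\<dots> = 2 * halfspace_dispersion M + emeasure lborel {-R..R}"
    unfolding halfspace_dispersion_def by (simp add: nn_integral_add nn_integral_cmult)
  \<comment> \<open>The error term contributes only the finite length of a bounded interval.\<close>
  also have "\<dots> < \<infinity>"
    using fin by (simp add: ennreal_mult_less_top emeasure_lborel_Icc_eq)
  finally show "(\<integral>\<^sup>+ y. ennreal \<bar>y\<bar> \<partial>M) < \<infinity>" .
qed

lemma simplicial_dispersion_le: "simplicial_dispersion M \<le> 2 * (\<integral>\<^sup>+ y. ennreal \<bar>y\<bar> \<partial>M)"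
proof -
  have "{p. fst p \<in> closed_segment 0 (snd p)} \<in> sets (borel \<Otimes>\<^sub>M M)"
    using sets_closed_segment_0 by (simp add: sets_pair_measure_cong[OF refl events_eq_borel])
  \<comment> \<open>The tail is the measure of the section at \<open>x\<close> of a jointly
    measurable set. Its measurability lets the factor 2 leave the integral below.\<close>
  then have [measurable]: "(\<lambda>x. prob {y. x \<in> closed_segment 0 y}) \<in> borel_measurable borel"
    using borel_measurable_enn2real[OF measurable_emeasure_Pair]
    by (fastforce simp: measure_def vimage_def)
  have "simplicial_dispersion M
      \<le> (\<integral>\<^sup>+ x. 2 * ennreal (prob {y. x \<in> closed_segment 0 y}) \<partial>lborel)"
    unfolding simplicial_dispersion_def
    by (intro nn_integral_mono order.trans[OF ennreal_leI[OF simplicial_depth_le_tail]])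
      (simp add: ennreal_mult)
  also have "\<dots> = 2 * (\<integral>\<^sup>+ y. ennreal \<bar>y\<bar> \<partial>M)"
    unfolding nn_integral_abs_eq_tail by (simp add: nn_integral_cmult)
  finally show ?thesis .
qed

end

theorem proposition7:
  fixes M :: "'a measure" and X :: "'a \<Rightarrow> real" and F :: "real measure"
  assumes "prob_space M"
    and "X \<in> borel_measurable M"
    and "F = distr M borel X"
  shows "(halfspace_dispersion F < \<infinity> \<longleftrightarrow> (\<integral>\<^sup>+ \<omega>. ennreal \<bar>X \<omega>\<bar> \<partial>M) < \<infinity>) \<and>
    ((\<integral>\<^sup>+ \<omega>. ennreal \<bar>X \<omega>\<bar> \<partial>M) < \<infinity> \<longrightarrow> simplicial_dispersion F < \<infinity>)"
proof -
  interpret F: real_distribution F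
    unfolding assms(3) using assms(1,2) by (rule prob_space.real_distribution_distr)
  \<comment> \<open>Change of variables turns the moment of \<open>X\<close> into one of its law, to
    which the results on real distributions apply.\<close>
  have "(\<integral>\<^sup>+ \<omega>. ennreal \<bar>X \<omega>\<bar> \<partial>M) = (\<integral>\<^sup>+ y. ennreal \<bar>y\<bar> \<partial>F)"
    unfolding assms(3) using assms(2) by (simp add: nn_integral_distr)
  moreover have "simplicial_dispersion F < \<infinity>" if "(\<integral>\<^sup>+ y. ennreal \<bar>y\<bar> \<partial>F) < \<infinity>"
    using F.simplicial_dispersion_le that
    by (auto simp: ennreal_mult_less_top intro: le_less_trans)
  ultimately show ?thesis
    using F.halfspace_dispersion_finite_iff by simp
qed

end
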